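(* Fix rationals $1<\alpha<\beta<2$, and for each $n\in\mathbb N$ let $Z_n=\{2^n(2t+1):t\in\mathbb N\}$. Then the sets $Z_n$ are pairwise disjoint, infinite, and uniformly computable. Define, for each $n,k\in\mathbb N$, $u_n(k)=\beta$ if $k\in Z_n$ and $u_n(k)=\alpha$ if $k\notin Z_n$, and let $D=\{(n,m)\in\mathbb N^2:n\ne m\}$. Then there exist a set $A\subseteq\mathbb N$ with $A\le_T\emptyset'$ and a uniformly computable family of total surjective functions $h_n:\mathbb N\to\mathbb N$ ($n\in\mathbb N$) forming a profile coding for $(\{u_n\}_{n\in\mathbb N},D)$, such that, with $W_n=C_n$ where $C_n(x)=A(h_n(x))$, one has $$W_n\equiv_{\rm bfo}A\quad\text{for every }n\in\mathbb N,$$ and $$W_n\not\le_1 W_m\quad\text{whenever }n\ne m.$$ Hence $\{\deg_1(W_n)\}_{n\in\mathbb N}$ is an infinite antichain of $1$-degrees inside a single bounded finite-one degree.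
   Context: Sets $A\subseteq\mathbb N=\{0,1,\dots\}$ are identified with their characteristic functions: $A(x)=1$ if $x\in A$, $A(x)=0$ otherwise. $\emptyset'$ is the Turing jump of the empty set. A family of functions $h_i$ is uniformly computable if $(i,x)\mapsto h_i(x)$ is computable; a family of sets is uniformly computable if its characteristic functions are. For $A,B\subseteq\mathbb N$: $A\le_1 B$ means there is a total computable injective $f:\mathbb N\to\mathbb N$ with $x\in A\iff f(x)\in B$ for all $x$. $A\le_{\rm bfo}B$ means there are a total computable $f:\mathbb N\to\mathbb N$ and a constant $c\ge1$ with $x\in A\iff f(x)\in B$ for all $x$ and $|f^{-1}(y)|\le c$ for all $y$. For $r\in\{1,{\rm bfo}\}$, $A\equiv_r B$ means $A\le_r B$ and $B\le_r A$. The equivalence classes of $\equiv_1$ are the $1$-degrees ($\deg_1(X)$ is that of $X$), those of $\equiv_{\rm bfo}$ the bounded finite-one degrees. Since $\le_1$ implies $\le_{\rm bfo}$, each bounded finite-one degree is a union of $1$-degrees; these are partially ordered by $\deg_1(X)\le\deg_1(Y)\iff X\le_1 Y$. Block-density profiles are functions $u:\mathbb N\to\mathbb Q\cap(1,2)$. Given a family of profiles $\{u_i\}_{i\in\mathbb N}$ and $D\subseteq\mathbb N^2$, say that $A$ and $(h_i)_{i\in\mathbb N}$ form a profile coding for $(\{u_i\},D)$ if, with $a_0=0$, $a_{k+1}=a_k+k!$, $I_k=[a_k,a_{k+1})$ and $C_i(x)=A(h_i(x))$: (a) $A$ is constant on each $I_k$; (b) $|h_i^{-1}(y)|\le2$ for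 all $i,y$; (c) $C_i\equiv_{\rm bfo}A$ for all $i$; (d) if $u_i(k)\le u_j(k)$ for all $k$, then $C_i\le_1 C_j$; (e) if $(i,j)\in D$, then $C_i\not\le_1 C_j$. *)

theory Defs
  imports Complex_Main "HOL-Library.Nat_Bijection" "HOL-Library.Disjoint_Sets"
begin

section \<open>Oracle computability\<close>

text \<open>
  Partial recursive functions relative to an oracle, in unary form: several arguments are packed
  with the Cantor pairing \<^const>\<open>prod_encode\<close>. \<open>Prec f g\<close> is primitive recursion, \<open>f\<close> giving the
  value at \<open>0\<close> and \<open>g\<close> the step; \<open>Mu f\<close> sends \<open>x\<close> to the least \<open>n\<close> with \<open>f (x, n) = 0\<close>, provided
  \<open>f (x, m)\<close> is defined for all \<open>m < n\<close>. The identity is \<open>Pair Fst Snd\<close>.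
\<close>

datatype prog =
    Zero | Succ | Fst | Snd | Oracle
  | Pair prog prog
  | Comp prog prog
  | Prec prog prog
  | Mu prog

text \<open>\<open>eval X c x y\<close>: the program \<open>c\<close> with oracle \<open>X\<close> halts on input \<open>x\<close> with output \<open>y\<close>.\<close>

inductive eval :: "nat set \<Rightarrow> prog \<Rightarrow> nat \<Rightarrow> nat \<Rightarrow> bool" for X where
  Zero: "eval X Zero x 0"
| Succ: "eval X Succ x (Suc x)"
| Fst: "eval X Fst (prod_encode (x, y)) x"
| Snd: "eval X Snd (prod_encode (x, y)) y"
| Oracle: "eval X Oracle x (of_bool (x \<in> X))"
| Pair: "eval X f x y \<Longrightarrow> eval X g x z \<Longrightarrow> eval X (Pair f g) x (prod_encode (y, z))"
| Comp: "eval X g x y \<Longrightarrow> eval X f y z \<Longrightarrow> eval X (Comp f g) x z"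
| Prec_0: "eval X f x y \<Longrightarrow> eval X (Prec f g) (prod_encode (x, 0)) y"
| Prec_Suc: "eval X (Prec f g) (prod_encode (x, n)) y
    \<Longrightarrow> eval X g (prod_encode (x, prod_encode (n, y))) z
    \<Longrightarrow> eval X (Prec f g) (prod_encode (x, Suc n)) z"
| Mu: "eval X f (prod_encode (x, n)) 0
    \<Longrightarrow> (\<And>m. m < n \<Longrightarrow> \<exists>y. eval X f (prod_encode (x, m)) (Suc y))
    \<Longrightarrow> eval X (Mu f) x n"

inductive_cases eval_ZeroE: "eval X Zero x y"
inductive_cases eval_SuccE: "eval X Succ x y"
inductive_cases eval_FstE: "eval X Fst x y"
inductive_cases eval_SndE: "eval X Snd x y"
inductive_cases eval_OracleE: "eval X Oracle x y"
inductive_cases eval_PairE: "eval X (Pair f g) x y"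
inductive_cases eval_CompE: "eval X (Comp f g) x y"
inductive_cases eval_PrecE: "eval X (Prec f g) x y"
inductive_cases eval_MuE: "eval X (Mu f) x y"

lemma eval_deterministic: "eval X c x y \<Longrightarrow> eval X c x z \<Longrightarrow> y = z"
proof (induction arbitrary: z rule: eval.induct)
  case (Zero x) then show ?case by (auto elim: eval_ZeroE)
next
  case (Succ x) then show ?case by (auto elim: eval_SuccE)
next
  case (Fst x y) then show ?case by (auto elim: eval_FstE)
next
  case (Snd x y) then show ?case by (auto elim: eval_SndE)
next
  case (Oracle x) then show ?case by (auto elim: eval_OracleE)
next
  case (Pair f x y g z) then show ?case by (metis eval_PairE)
next
  case (Comp g x y f z) then show ?case by (metis eval_CompE)
next
  case (Prec_0 f x y g)
  from Prec_0.prems show ?case by (rule eval_PrecE) (auto intro: Prec_0.IH)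
next
  case (Prec_Suc f g x n y z)
  from Prec_Suc.prems show ?case by (rule eval_PrecE) (auto dest!: Prec_Suc.IH)
next
  case (Mu f x n)
  from Mu.prems show ?case
  proof (rule eval_MuE)
    assume z: "eval X f (prod_encode (x, z)) 0"
      and below: "\<And>m. m < z \<Longrightarrow> \<exists>y. eval X f (prod_encode (x, m)) (Suc y)"
    have "\<not> n < z" using below Mu.IH(1) by blast
    moreover have "\<not> z < n" using Mu.IH(2) z by blast
    ultimately show ?case by simp
  qed
qed

definition computable_in :: "nat set \<Rightarrow> (nat \<Rightarrow> nat) \<Rightarrow> bool" where
  "computable_in X f \<longleftrightarrow> (\<exists>c. \<forall>x. eval X c x (f x))"

abbreviation computable :: "(nat \<Rightarrow> nat) \<Rightarrow> bool" where
  "computable \<equiv> computable_in {}"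

lemma computable_in_id: "computable_in X id"
proof -
  have "eval X (Pair Fst Snd) x x" for x
    by (metis eval.Fst eval.Pair eval.Snd prod_decode_inverse surj_pair)
  then show ?thesis by (auto simp: computable_in_def)
qed

lemma computable_in_comp: "computable_in X f \<Longrightarrow> computable_in X g \<Longrightarrow> computable_in X (f \<circ> g)"
  unfolding computable_in_def o_def by (metis eval.Comp)

definition uniformly_computable :: "(nat \<Rightarrow> nat \<Rightarrow> nat) \<Rightarrow> bool" where
  "uniformly_computable h \<longleftrightarrow> computable (\<lambda>p. case prod_decode p of (i, x) \<Rightarrow> h i x)"

definition uniformly_computable_sets :: "(nat \<Rightarrow> nat set) \<Rightarrow> bool" where
  "uniformly_computable_sets Z \<longleftrightarrow> uniformly_computable (\<lambda>i x. of_bool (x \<in> Z i))"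

definition turing_reducible :: "nat set \<Rightarrow> nat set \<Rightarrow> bool"  (infix "\<le>\<^sub>T" 50) where
  "A \<le>\<^sub>T B \<longleftrightarrow> computable_in B (\<lambda>x. of_bool (x \<in> A))"

text \<open>A Goedel numbering of programs, used only to state the halting problem.\<close>

fun prog_number :: "prog \<Rightarrow> nat" where
  "prog_number Zero = 0"
| "prog_number Succ = 1"
| "prog_number Fst = 2"
| "prog_number Snd = 3"
| "prog_number Oracle = 4"
| "prog_number (Pair f g) = 5 + 4 * prod_encode (prog_number f, prog_number g)"
| "prog_number (Comp f g) = 6 + 4 * prod_encode (prog_number f, prog_number g)"
| "prog_number (Prec f g) = 7 + 4 * prod_encode (prog_number f, prog_number g)"
| "prog_number (Mu f) = 8 + 4 * prog_number f"

lemma prog_number_inject: "prog_number c = prog_number d \<Longrightarrow> c = d"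
proof (induction c arbitrary: d)
  case Zero then show ?case by (cases d) auto
next
  case Succ then show ?case by (cases d) auto
next
  case Fst then show ?case by (cases d) auto
next
  case Snd then show ?case by (cases d) auto
next
  case Oracle then show ?case by (cases d) auto
next
  case (Pair f g) then show ?case
    by (cases d) (auto, presburger+)
next
  case (Comp f g) then show ?case
    by (cases d) (auto, presburger+)
next
  case (Prec f g) then show ?case
    by (cases d) (auto, presburger+)
next
  case (Mu f) then show ?case
    by (cases d) (auto, presburger+)
qed

lemma prog_number_surj: "\<exists>c. prog_number c = n"
proof (induction n rule: less_induct)
  case (less n)
  show ?case
  proof (cases "n < 5")
    case True
    then have "n = 0 \<or> n = 1 \<or> n = 2 \<or> n = 3 \<or> n = 4" by auto
    then show ?thesis
      by (metis prog_number.simps(1-5))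
  next
    case False
    define q where "q = (n - 5) div 4"
    obtain a b where ab: "q = prod_encode (a, b)" by (metis prod_decode_inverse surj_pair)
    have "a \<le> q" "b \<le> q" using ab le_prod_encode_1 le_prod_encode_2 by auto
    moreover have "q < n" using False by (auto simp: q_def)
    ultimately obtain f g h
      where "prog_number f = a" "prog_number g = b" "prog_number h = q"
      using less.IH by (metis le_less_trans)
    moreover have "n = 5 + 4 * q \<or> n = 6 + 4 * q \<or> n = 7 + 4 * q \<or> n = 8 + 4 * q"
      using False unfolding q_def by presburger
    ultimately show ?thesis
      using ab by (metis prog_number.simps(6-9))
  qed
qed

lemma bij_prog_number: "bij prog_number"
  by (metis bijI injI prog_number_inject prog_number_surj surjI surj_def)

definition turing_jump :: "nat set \<Rightarrow> nat set" where
  "turing_jump X = {e. \<exists>c y. prog_number c = e \<and> eval X c e y}"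

section \<open>Reducibilities and degrees\<close>

definition one_reducible :: "nat set \<Rightarrow> nat set \<Rightarrow> bool"  (infix "\<le>\<^sub>1" 50) where
  "A \<le>\<^sub>1 B \<longleftrightarrow> (\<exists>f. computable f \<and> inj f \<and> (\<forall>x. x \<in> A \<longleftrightarrow> f x \<in> B))"

definition bfo_reducible :: "nat set \<Rightarrow> nat set \<Rightarrow> bool"  (infix "\<le>\<^sub>b\<^sub>f\<^sub>o" 50) where
  "A \<le>\<^sub>b\<^sub>f\<^sub>o B \<longleftrightarrow> (\<exists>f c. computable f \<and> c \<ge> 1 \<and> (\<forall>x. x \<in> A \<longleftrightarrow> f x \<in> B)
     \<and> (\<forall>y. finite (f -` {y}) \<and> card (f -` {y}) \<le> c))"

definition one_equiv :: "nat set \<Rightarrow> nat set \<Rightarrow> bool"  (infix "\<equiv>\<^sub>1" 50) where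
  "A \<equiv>\<^sub>1 B \<longleftrightarrow> A \<le>\<^sub>1 B \<and> B \<le>\<^sub>1 A"

definition bfo_equiv :: "nat set \<Rightarrow> nat set \<Rightarrow> bool"  (infix "\<equiv>\<^sub>b\<^sub>f\<^sub>o" 50) where
  "A \<equiv>\<^sub>b\<^sub>f\<^sub>o B \<longleftrightarrow> A \<le>\<^sub>b\<^sub>f\<^sub>o B \<and> B \<le>\<^sub>b\<^sub>f\<^sub>o A"

definition one_degree :: "nat set \<Rightarrow> nat set set" where
  "one_degree X = {Y. Y \<equiv>\<^sub>1 X}"

definition bfo_degree :: "nat set \<Rightarrow> nat set set" where
  "bfo_degree X = {Y. Y \<equiv>\<^sub>b\<^sub>f\<^sub>o X}"

definition one_degree_le :: "nat set set \<Rightarrow> nat set set \<Rightarrow> bool" where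
  "one_degree_le d e \<longleftrightarrow> (\<exists>X\<in>d. \<exists>Y\<in>e. X \<le>\<^sub>1 Y)"

lemma one_reducible_refl: "X \<le>\<^sub>1 X"
  unfolding one_reducible_def using computable_in_id by (intro exI[of _ id]) auto

lemma one_reducible_trans:
  assumes "X \<le>\<^sub>1 Y" "Y \<le>\<^sub>1 Z"
  shows "X \<le>\<^sub>1 Z"
proof -
  obtain f where f: "computable f" "inj f" "\<forall>x. x \<in> X \<longleftrightarrow> f x \<in> Y"
    using assms(1) by (auto simp: one_reducible_def)
  obtain g where g: "computable g" "inj g" "\<forall>x. x \<in> Y \<longleftrightarrow> g x \<in> Z"
    using assms(2) by (auto simp: one_reducible_def)
  show ?thesis
    unfolding one_reducible_def
    by (rule exI[of _ "g \<circ> f"]) (use f g in \<open>auto intro: computable_in_comp inj_compose\<close>)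
qed

lemma one_degree_le_iff: "one_degree_le (one_degree X) (one_degree Y) \<longleftrightarrow> X \<le>\<^sub>1 Y"
  unfolding one_degree_le_def one_degree_def one_equiv_def
  using one_reducible_refl one_reducible_trans by blast

section \<open>Profile codings\<close>

definition block_density_profile :: "(nat \<Rightarrow> rat) \<Rightarrow> bool" where
  "block_density_profile u \<longleftrightarrow> range u \<subseteq> {1<..<2}"

fun block_start :: "nat \<Rightarrow> nat" where
  "block_start 0 = 0"
| "block_start (Suc k) = block_start k + fact k"

definition block :: "nat \<Rightarrow> nat set" where
  "block k = {block_start k..<block_start (Suc k)}"

definition coded_set :: "nat set \<Rightarrow> (nat \<Rightarrow> nat \<Rightarrow> nat) \<Rightarrow> nat \<Rightarrow> nat set" where
  "coded_set A h i = {x. h i x \<in> A}"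

definition profile_coding ::
    "(nat \<Rightarrow> nat \<Rightarrow> rat) \<Rightarrow> (nat \<times> nat) set \<Rightarrow> nat set \<Rightarrow> (nat \<Rightarrow> nat \<Rightarrow> nat) \<Rightarrow> bool" where
  "profile_coding u D A h \<longleftrightarrow>
     (\<forall>k. \<forall>x\<in>block k. \<forall>y\<in>block k. x \<in> A \<longleftrightarrow> y \<in> A) \<and>
     (\<forall>i y. finite (h i -` {y}) \<and> card (h i -` {y}) \<le> 2) \<and>
     (\<forall>i. coded_set A h i \<equiv>\<^sub>b\<^sub>f\<^sub>o A) \<and>
     (\<forall>i j. (\<forall>k. u i k \<le> u j k) \<longrightarrow> coded_set A h i \<le>\<^sub>1 coded_set A h j) \<and>
     (\<forall>(i, j)\<in>D. \<not> coded_set A h i \<le>\<^sub>1 coded_set A h j)"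

definition dyadic_class :: "nat \<Rightarrow> nat set" where
  "dyadic_class n = {2 ^ n * (2 * t + 1) | t. True}"

definition dyadic_profile :: "rat \<Rightarrow> rat \<Rightarrow> nat \<Rightarrow> nat \<Rightarrow> rat" where
  "dyadic_profile \<alpha> \<beta> n k = (if k \<in> dyadic_class n then \<beta> else \<alpha>)"

end

theory Submission
  imports Defs "HOL-Library.Infinite_Set"
begin

text \<open>
  Since the classes \<open>Z_n\<close> are disjoint and nonempty, \<open>u_n \<le> u_m\<close> holds only for \<open>n = m\<close>, so the coding
  maps need not realise the densities \<open>\<alpha>\<close> and \<open>\<beta>\<close> exactly: \<open>h_n\<close> covers the blocks with index in
  \<open>Z_n\<close> twice and all others once. The set \<open>A\<close> is the union of the blocks \<open>I_k\<close> with \<open>k\<close> in a sequence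
  \<open>r\<close> that is computable from the halting problem, meets every \<open>Z_n\<close> infinitely often, and grows faster
  than every computable function. An injective reduction of \<open>W_n\<close> to \<open>W_m\<close> must map the \<open>2 k!\<close> elements
  over \<open>I_k\<close>, where \<open>k \<in> Z_n\<close> is a large member of the sequence, into \<open>W_m\<close>; by the growth of \<open>r\<close> it
  cannot reach the next block of \<open>A\<close>, and up to \<open>I_k\<close> there are only \<open>k! + O((k - 1)!)\<close> elements.
\<close>

section \<open>Closure properties of the computable functions\<close>

abbreviation pfst :: "nat \<Rightarrow> nat" where "pfst p \<equiv> fst (prod_decode p)"
abbreviation psnd :: "nat \<Rightarrow> nat" where "psnd p \<equiv> snd (prod_decode p)"

abbreviation decidable_in :: "nat set \<Rightarrow> (nat \<Rightarrow> bool) \<Rightarrow> bool" where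
  "decidable_in X P \<equiv> computable_in X (\<lambda>x. of_bool (P x))"

fun const_prog :: "nat \<Rightarrow> prog" where
  "const_prog 0 = Zero"
| "const_prog (Suc n) = Comp Succ (const_prog n)"

lemma eval_const_prog: "eval X (const_prog n) x n"
  by (induction n) (auto intro: eval.intros)

text \<open>Composing with \<open>const_prog x\<close> hard-wires the input. The jump only asks
  whether a program halts on its own number, so halting on any other input has to be asked in this
  form.\<close>

lemma eval_Comp_const_prog: "eval X (Comp c (const_prog x)) w z \<longleftrightarrow> eval X c x z"
proof
  assume "eval X (Comp c (const_prog x)) w z"
  then obtain y where "eval X (const_prog x) w y" "eval X c y z" by (rule eval_CompE)
  then show "eval X c x z" using eval_deterministic[OF eval_const_prog] by metis
qed (rule eval.Comp[OF eval_const_prog])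

lemma eval_Fst_pfst: "eval X Fst p (pfst p)"
  by (metis eval.Fst prod.collapse prod_decode_inverse)

lemma eval_Snd_psnd: "eval X Snd p (psnd p)"
  by (metis eval.Snd prod.collapse prod_decode_inverse)

lemma computable_ident: "computable_in X (\<lambda>x. x)"
  using computable_in_id[of X] by (simp add: id_def)

lemma computable_const: "computable_in X (\<lambda>x. n)"
  unfolding computable_in_def using eval_const_prog by blast

lemma computable_compose:
  "computable_in X f \<Longrightarrow> computable_in X g \<Longrightarrow> computable_in X (\<lambda>x. f (g x))"
  using computable_in_comp[of X f g] by (simp add: o_def)

lemma computable_Suc: "computable_in X f \<Longrightarrow> computable_in X (\<lambda>x. Suc (f x))"
  unfolding computable_in_def by (metis eval.Comp eval.Succ)

lemma computable_pfst: "computable_in X f \<Longrightarrow> computable_in X (\<lambda>x. pfst (f x))"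
  unfolding computable_in_def by (metis eval.Comp eval_Fst_pfst)

lemma computable_psnd: "computable_in X f \<Longrightarrow> computable_in X (\<lambda>x. psnd (f x))"
  unfolding computable_in_def by (metis eval.Comp eval_Snd_psnd)

lemma computable_pair:
  "computable_in X f \<Longrightarrow> computable_in X g \<Longrightarrow> computable_in X (\<lambda>x. prod_encode (f x, g x))"
  unfolding computable_in_def by (metis eval.Pair)

lemma computable_compose2:
  assumes "computable_in X (\<lambda>p. F (pfst p) (psnd p))" "computable_in X f" "computable_in X g"
  shows "computable_in X (\<lambda>x. F (f x) (g x))"
  using computable_compose[OF assms(1) computable_pair[OF assms(2,3)]] by simp

lemma computable_rec:
  assumes "computable_in X f"
    and "computable_in X (\<lambda>p. g (pfst p) (pfst (psnd p)) (psnd (psnd p)))"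
    and "computable_in X b"
  shows "computable_in X (\<lambda>x. rec_nat (f x) (g x) (b x))"
proof -
  obtain cf where cf: "\<And>x. eval X cf x (f x)"
    using assms(1) by (auto simp: computable_in_def)
  obtain cg where cg: "\<And>p. eval X cg p (g (pfst p) (pfst (psnd p)) (psnd (psnd p)))"
    using assms(2) by (auto simp: computable_in_def)
  have "eval X (Prec cf cg) (prod_encode (x, n)) (rec_nat (f x) (g x) n)" for x n
  proof (induction n)
    case 0
    show ?case using cf by (auto intro: eval.Prec_0)
  next
    case (Suc n)
    show ?case
      using eval.Prec_Suc[OF Suc] cg[of "prod_encode (x, prod_encode (n, rec_nat (f x) (g x) n))"]
      by simp
  qed
  then have "eval X (Prec cf cg) p (rec_nat (f (pfst p)) (g (pfst p)) (psnd p))" for p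
    by (metis prod.collapse prod_decode_inverse)
  then have "computable_in X (\<lambda>p. rec_nat (f (pfst p)) (g (pfst p)) (psnd p))"
    unfolding computable_in_def by blast
  \<comment> \<open>The input is used twice: as the parameter of the recursion and, through
    \<open>b\<close>, to determine its length.\<close>
  from computable_compose2[OF this computable_ident assms(3)] show ?thesis .
qed

lemma computable_pred: "computable_in X f \<Longrightarrow> computable_in X (\<lambda>x. f x - 1)"
proof -
  assume f: "computable_in X f"
  have "n - 1 = rec_nat 0 (\<lambda>n _. n) n" for n :: nat by (cases n) auto
  then show ?thesis
    by (simp only:) (intro computable_rec computable_const computable_pfst computable_psnd
        computable_ident f)
qed

lemma computable_diff:
  assumes "computable_in X f" "computable_in X g"
  shows "computable_in X (\<lambda>x. f x - g x)"
proof -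
  have "m - n = rec_nat m (\<lambda>_ y. y - 1) n" for m n :: nat by (induction n) auto
  \<comment> \<open>The recursion step is a truncated difference again, so the equation is applied
    once, to the function as a whole.\<close>
  then have "(\<lambda>x. f x - g x) = (\<lambda>x. rec_nat (f x) (\<lambda>_ y. y - 1) (g x))" by blast
  moreover have "computable_in X \<dots>"
    by (intro computable_rec computable_pred computable_psnd computable_ident assms)
  ultimately show ?thesis by (simp only:)
qed

lemma computable_add:
  assumes "computable_in X f" "computable_in X g"
  shows "computable_in X (\<lambda>x. f x + g x)"
proof -
  have "m + n = rec_nat m (\<lambda>_ y. Suc y) n" for m n :: nat by (induction n) auto
  then show ?thesis
    by (simp only:) (intro computable_rec computable_Suc computable_psnd computable_ident assms)
qed

lemma computable_mult:
  assumes "computable_in X f" "computable_in X g"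
  shows "computable_in X (\<lambda>x. f x * g x)"
proof -
  have "m * n = rec_nat 0 (\<lambda>_ y. y + m) n" for m n :: nat by (induction n) auto
  then show ?thesis
    by (simp only:) (intro computable_rec computable_add computable_const computable_psnd
        computable_ident assms computable_compose[OF assms(1)] computable_pfst)
qed

lemma computable_power:
  assumes "computable_in X f" "computable_in X g"
  shows "computable_in X (\<lambda>x. f x ^ g x)"
proof -
  have "m ^ n = rec_nat 1 (\<lambda>_ y. y * m) n" for m n :: nat by (induction n) auto
  then show ?thesis
    by (simp only:) (intro computable_rec computable_mult computable_const computable_psnd
        computable_ident assms computable_compose[OF assms(1)] computable_pfst)
qed

lemma computable_fact:
  assumes "computable_in X f"
  shows "computable_in X (\<lambda>x. fact (f x))"
proof -
  have "fact n = rec_nat 1 (\<lambda>i y. Suc i * y) n" for n :: nat by (induction n) auto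
  then show ?thesis
    by (simp only:) (intro computable_rec computable_mult computable_const computable_psnd
        computable_ident assms computable_pfst computable_Suc)
qed

lemma computable_sum:
  assumes "computable_in X (\<lambda>p. f (pfst p) (psnd p))" "computable_in X b"
  shows "computable_in X (\<lambda>x. \<Sum>i<b x. f x i)"
proof -
  have "(\<Sum>i<n. f x i) = rec_nat 0 (\<lambda>i y. y + f x i) n" for x n :: nat by (induction n) auto
  then show ?thesis
    by (simp only:) (intro computable_rec computable_add computable_const computable_psnd
        computable_ident assms computable_pfst computable_compose2[OF assms(1)])
qed

lemma computable_block_start:
  assumes "computable_in X f"
  shows "computable_in X (\<lambda>x. block_start (f x))"
proof -
  have "block_start n = (\<Sum>k<n. fact k)" for n by (induction n) auto
  then show ?thesis
    by (simp only:) (intro computable_sum computable_fact computable_psnd computable_ident assms)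
qed

section \<open>Decidable predicates and search\<close>

lemma decidable_not:
  assumes "decidable_in X P"
  shows "decidable_in X (\<lambda>x. \<not> P x)"
proof -
  have "of_bool (\<not> p) = 1 - (of_bool p :: nat)" for p by simp
  then show ?thesis
    by (simp only:) (intro computable_diff computable_const assms)
qed

lemma decidable_conj:
  "decidable_in X P \<Longrightarrow> decidable_in X Q \<Longrightarrow> decidable_in X (\<lambda>x. P x \<and> Q x)"
  unfolding of_bool_conj by (intro computable_mult)

lemma decidable_imp:
  "decidable_in X P \<Longrightarrow> decidable_in X Q \<Longrightarrow> decidable_in X (\<lambda>x. P x \<longrightarrow> Q x)"
  using decidable_not[OF decidable_conj[OF _ decidable_not]] by simp

lemma decidable_le:
  assumes "computable_in X f" "computable_in X g"
  shows "decidable_in X (\<lambda>x. f x \<le> g x)"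
proof -
  have "of_bool (m \<le> n) = 1 - (m - n)" for m n :: nat by auto
  then show ?thesis
    by (simp only:) (intro computable_diff computable_const assms)
qed

lemma decidable_less:
  "computable_in X f \<Longrightarrow> computable_in X g \<Longrightarrow> decidable_in X (\<lambda>x. f x < g x)"
  unfolding not_le[symmetric] by (intro decidable_not decidable_le)

lemma decidable_eq:
  "computable_in X f \<Longrightarrow> computable_in X g \<Longrightarrow> decidable_in X (\<lambda>x. f x = g x)"
  unfolding order.eq_iff[where ?'a = nat] by (intro decidable_conj decidable_le)

text \<open>Bounded search by counting: a witness below the bound exists exactly when the number of
  witnesses there is positive.\<close>

lemma decidable_bex:
  assumes "decidable_in X (\<lambda>p. P (pfst p) (psnd p))" "computable_in X b"
  shows "decidable_in X (\<lambda>x. \<exists>i<b x. P x i)"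
proof -
  have "(\<exists>i<n. P x i) \<longleftrightarrow> 0 < (\<Sum>i<n. of_bool (P x i) :: nat)" for x n
    by (auto simp: sum_pos2 zero_less_iff_neq_zero)
  then show ?thesis
    by (simp only:) (intro decidable_less computable_const computable_sum assms)
qed

lemma decidable_mem: "computable_in X f \<Longrightarrow> decidable_in X (\<lambda>x. f x \<in> X)"
  unfolding computable_in_def by (metis eval.Comp eval.Oracle)

lemma computable_Least:
  assumes "decidable_in X (\<lambda>p. P (pfst p) (psnd p))" and ex: "\<And>x. \<exists>n. P x n"
  shows "computable_in X (\<lambda>x. LEAST n. P x n)"
proof -
  \<comment> \<open>\<open>Mu\<close> looks for a zero, so the program must return 0 where
    \<open>P\<close> holds; hence the negation.\<close>
  from decidable_not[OF assms(1)] obtain c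
    where c: "\<And>p. eval X c p (of_bool (\<not> P (pfst p) (psnd p)))"
    by (auto simp: computable_in_def)
  have c': "eval X c (prod_encode (x, n)) (of_bool (\<not> P x n))" for x n
    using c[of "prod_encode (x, n)"] by simp
  have "eval X (Mu c) x (LEAST n. P x n)" for x
  proof (rule eval.Mu)
    show "eval X c (prod_encode (x, LEAST n. P x n)) 0"
      using c'[of x "LEAST n. P x n"] LeastI_ex[OF ex[of x]] by simp
    show "\<exists>y. eval X c (prod_encode (x, m)) (Suc y)" if "m < (LEAST n. P x n)" for m
      using c'[of x m] not_less_Least[OF that] by auto
  qed
  then show ?thesis unfolding computable_in_def by blast
qed

text \<open>Both branches are total, so both can be evaluated and one selected by multiplying with 0
  or 1.\<close>

lemma computable_if:
  assumes "decidable_in X P" "computable_in X f" "computable_in X g"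
  shows "computable_in X (\<lambda>x. if P x then f x else g x)"
proof -
  have "(if p then m else n) = of_bool p * m + of_bool (\<not> p) * n" for p and m n :: nat
    by simp
  then show ?thesis
    by (simp only:) (intro computable_add computable_mult decidable_not assms)
qed

lemmas computable_intros =
  computable_const computable_ident computable_Suc computable_pfst computable_psnd
  computable_pair computable_diff computable_add computable_mult computable_power
  computable_fact computable_sum computable_block_start
  decidable_not decidable_conj decidable_imp decidable_le decidable_less decidable_eq
  decidable_bex computable_if

text \<open>The enumeration is an iterated search for the next larger element. Infinity of each
  \<open>S i\<close> makes every search succeed, and the recursion is uniform in
  \<open>i\<close>.\<close>

lemma computable_enumerate:
  assumes dec: "decidable_in X (\<lambda>p. psnd p \<in> S (pfst p))" and inf: "\<And>i. infinite (S i)"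
    and "computable_in X f" "computable_in X b"
  shows "computable_in X (\<lambda>x. enumerate (S (f x)) (b x))"
proof -
  have ex: "\<exists>s. s \<in> S i" "\<exists>s. s \<in> S i \<and> y < s" for i y
    using inf[of i] by (auto simp: infinite_nat_iff_unbounded)
  have "enumerate (S i) n =
      rec_nat (LEAST s. s \<in> S i) (\<lambda>_ y. LEAST s. s \<in> S i \<and> y < s) n" for i n
    by (induction n) (simp_all add: enumerate_0 enumerate_Suc''[OF inf])
  then show ?thesis
    by (simp only:)
      (intro computable_rec computable_Least ex computable_intros computable_compose2[OF dec]
        assms(3,4) computable_compose[OF assms(3)])
qed

lemma uniformly_computable_iff:
  "uniformly_computable h \<longleftrightarrow> computable (\<lambda>p. h (pfst p) (psnd p))"
  by (simp add: uniformly_computable_def split_beta)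

section \<open>A dominating function below the jump\<close>

lemma prog_number_in_turing_jump:
  "prog_number c \<in> turing_jump X \<longleftrightarrow> (\<exists>y. eval X c (prog_number c) y)"
  by (auto simp: turing_jump_def dest: prog_number_inject)

lemma computable_prog_number_const_prog:
  assumes "computable_in X f"
  shows "computable_in X (\<lambda>x. prog_number (const_prog (f x)))"
proof -
  \<comment> \<open>Each step wraps the program in \<open>Comp Succ\<close>: 6 is the offset of
    \<open>Comp\<close> and 1 is the number of \<open>Succ\<close>.\<close>
  have "prog_number (const_prog n) = rec_nat 0 (\<lambda>_ y. 6 + 4 * prod_encode (1, y)) n" for n
    by (induction n) auto
  then show ?thesis
    by (simp only:) (intro computable_rec computable_intros assms)
qed

text \<open>This turns a question about an output value into one about halting. The program
  minimises a test that ignores the search variable: it stops at 0 if the two components agree and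
  never stops otherwise.\<close>

lemma equality_test_prog:
  "\<exists>E. \<forall>a b. (\<exists>y. eval X E (prod_encode (a, b)) y) \<longleftrightarrow> a = b"
proof -
  have "decidable_in X (\<lambda>p. pfst (pfst p) \<noteq> psnd (pfst p))"
    by (intro computable_intros)
  then obtain c where c: "\<And>p. eval X c p (of_bool (pfst (pfst p) \<noteq> psnd (pfst p)))"
    by (auto simp: computable_in_def)
  have c': "eval X c (prod_encode (prod_encode (a, b), n)) (of_bool (a \<noteq> b))" for a b n
    using c[of "prod_encode (prod_encode (a, b), n)"] by simp
  show ?thesis
  proof (intro exI allI)
    fix a b
    show "(\<exists>y. eval X (Mu c) (prod_encode (a, b)) y) \<longleftrightarrow> a = b"
    proof
      assume "a = b"
      then have "eval X (Mu c) (prod_encode (a, b)) 0"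
        using c'[of a b] by (intro eval.Mu) auto
      then show "\<exists>y. eval X (Mu c) (prod_encode (a, b)) y" ..
    next
      assume "\<exists>y. eval X (Mu c) (prod_encode (a, b)) y"
      then obtain n where "eval X c (prod_encode (prod_encode (a, b), n)) 0"
        by (auto elim: eval_MuE)
      from eval_deterministic[OF this c'] show "a = b" by (auto simp: of_bool_def split: if_splits)
    qed
  qed
qed

text \<open>
  No universal program is needed: \<open>eval X c x y\<close> is itself the halting of a program whose number
  is computable from those of \<open>c\<close>, \<open>x\<close> and \<open>y\<close>, so the jump finds the value by search.
\<close>

lemma turing_jump_dominating:
  "\<exists>g. computable_in (turing_jump X) g \<and>
     (\<forall>f. computable_in X f \<longrightarrow> (\<exists>k. \<forall>x\<ge>k. f x \<le> g x))"
proof -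
  obtain E where E: "\<And>a b. (\<exists>y. eval X E (prod_encode (a, b)) y) \<longleftrightarrow> a = b"
    using equality_test_prog[of X] by auto
  \<comment> \<open>\<open>halt\<close> numbers the program \<open>e\<close> with input
    \<open>x\<close> hard-wired; \<open>val\<close> numbers the program that passes its output
    together with \<open>y\<close> to the equality test. Both unfold \<open>prog_number\<close>,
    with 6 for \<open>Comp\<close> and 5 for \<open>Pair\<close>, and so are computable
    arithmetic.\<close>
  define halt where "halt e x = 6 + 4 * prod_encode (e, prog_number (const_prog x))" for e x
  define val where
    "val e x y = 6 + 4 * prod_encode (prog_number E,
       5 + 4 * prod_encode (halt e x, prog_number (const_prog y)))" for e x y
  have halt_iff: "halt (prog_number c) x \<in> turing_jump X \<longleftrightarrow> (\<exists>z. eval X c x z)" for c x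
  proof -
    have "halt (prog_number c) x = prog_number (Comp c (const_prog x))"
      by (simp add: halt_def)
    then show ?thesis
      by (simp only: prog_number_in_turing_jump eval_Comp_const_prog)
  qed
  have val_iff: "val (prog_number c) x y \<in> turing_jump X \<longleftrightarrow> eval X c x y" for c x y
  proof -
    let ?P = "Pair (Comp c (const_prog x)) (const_prog y)"
    have P: "eval X ?P w v \<longleftrightarrow> (\<exists>z. v = prod_encode (z, y) \<and> eval X c x z)" for w v
    proof
      assume "eval X ?P w v"
      then obtain z y' where v: "v = prod_encode (z, y')"
        and z: "eval X (Comp c (const_prog x)) w z" and y': "eval X (const_prog y) w y'"
        by (rule eval_PairE)
      have "y' = y" using y' eval_const_prog by (rule eval_deterministic)
      then show "\<exists>z. v = prod_encode (z, y) \<and> eval X c x z"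
        using v z by (simp add: eval_Comp_const_prog)
    next
      assume "\<exists>z. v = prod_encode (z, y) \<and> eval X c x z"
      then obtain z where v: "v = prod_encode (z, y)" and z: "eval X c x z" by blast
      have "eval X (Comp c (const_prog x)) w z" using z by (simp only: eval_Comp_const_prog)
      then show "eval X ?P w v" unfolding v by (rule eval.Pair[OF _ eval_const_prog])
    qed
    \<comment> \<open>The input \<open>w\<close> is irrelevant, so it may be the program's own
      number, as in the jump.\<close>
    have "(\<exists>v. eval X (Comp E ?P) w v) \<longleftrightarrow> eval X c x y" for w
    proof
      assume "\<exists>v. eval X (Comp E ?P) w v"
      then obtain v where "eval X (Comp E ?P) w v" ..
      then obtain u where u: "eval X ?P w u" and v: "eval X E u v" by (rule eval_CompE)
      from u obtain z where "u = prod_encode (z, y)" "eval X c x z" unfolding P by blast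
      with v E[of z y] show "eval X c x y" by auto
    next
      assume "eval X c x y"
      then have "eval X ?P w (prod_encode (y, y))" unfolding P by blast
      moreover obtain v where "eval X E (prod_encode (y, y)) v" using E[of y y] by auto
      ultimately have "eval X (Comp E ?P) w v" by (rule eval.Comp)
      then show "\<exists>v. eval X (Comp E ?P) w v" ..
    qed
    moreover have "val (prog_number c) x y = prog_number (Comp E ?P)"
      by (simp add: val_def halt_def)
    ultimately show ?thesis
      by (simp only: prog_number_in_turing_jump)
  qed
  \<comment> \<open>The premise makes the search total: where the program diverges, the condition is
    vacuous and the value is 0.\<close>
  define v where "v e x = (LEAST y. halt e x \<in> turing_jump X \<longrightarrow> val e x y \<in> turing_jump X)" for e x
  have ex: "\<exists>y. halt e x \<in> turing_jump X \<longrightarrow> val e x y \<in> turing_jump X" for e x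
  proof -
    obtain c where "prog_number c = e" using prog_number_surj[of e] ..
    then show ?thesis using halt_iff[of c x] val_iff[of c x] by auto
  qed
  have v_eq: "v (prog_number c) x = y" if "eval X c x y" for c x y
    unfolding v_def halt_iff val_iff
  proof (rule Least_equality)
    fix z assume "(\<exists>z. eval X c x z) \<longrightarrow> eval X c x z"
    with that have "eval X c x z" by blast
    with that have "y = z" by (rule eval_deterministic)
    then show "y \<le> z" by simp
  qed (use that in blast)
  have v_comp: "computable_in (turing_jump X) (\<lambda>p. v (pfst p) (psnd p))"
    unfolding v_def
  proof (rule computable_Least)
    show "decidable_in (turing_jump X) (\<lambda>p. halt (pfst (pfst p)) (psnd (pfst p)) \<in> turing_jump X
        \<longrightarrow> val (pfst (pfst p)) (psnd (pfst p)) (psnd p) \<in> turing_jump X)"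
      unfolding halt_def val_def
      by (intro decidable_imp decidable_mem computable_const computable_prog_number_const_prog
          computable_add computable_mult computable_pair computable_pfst computable_psnd
          computable_ident)
  qed (rule ex)
  \<comment> \<open>Summing over all programs with number at most \<open>x\<close> bounds each total
    function from the number of its program onwards.\<close>
  define g where "g x = (\<Sum>e<Suc x. v e x)" for x
  show ?thesis
  proof (intro exI[of _ g] conjI allI impI)
    show "computable_in (turing_jump X) g"
      unfolding g_def by (intro computable_intros computable_compose2[OF v_comp])
    fix f assume "computable_in X f"
    then obtain c where c: "\<And>x. eval X c x (f x)" by (auto simp: computable_in_def)
    have "f x \<le> g x" if "x \<ge> prog_number c" for x
    proof -
      have "f x = v (prog_number c) x" using v_eq[OF c] by simp
      also have "\<dots> \<le> g x" unfolding g_def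
        using that by (intro member_le_sum[of "prog_number c" _ "\<lambda>e. v e x"]) auto
      finally show ?thesis .
    qed
    then show "\<exists>k. \<forall>x\<ge>k. f x \<le> g x" by blast
  qed
qed

section \<open>Dyadic classes\<close>

text \<open>The class index is the exact exponent of 2 in \<open>k\<close>, whence disjointness; 0
  lies in no class.\<close>

lemma dyadic_class_dvd_iff: "k \<in> dyadic_class n \<longleftrightarrow> 2 ^ n dvd k \<and> \<not> 2 ^ Suc n dvd k"
proof -
  have "k \<in> dyadic_class n \<longleftrightarrow> (\<exists>q. k = 2 ^ n * q \<and> odd q)"
  proof
    assume "k \<in> dyadic_class n"
    then obtain t where "k = 2 ^ n * (2 * t + 1)" unfolding dyadic_class_def by blast
    then show "\<exists>q. k = 2 ^ n * q \<and> odd q" by (intro exI[of _ "2 * t + 1"]) simp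
  next
    assume "\<exists>q. k = 2 ^ n * q \<and> odd q"
    then show "k \<in> dyadic_class n" unfolding dyadic_class_def by (blast elim: oddE)
  qed
  also have "\<dots> \<longleftrightarrow> 2 ^ n dvd k \<and> \<not> 2 ^ Suc n dvd k"
    by (auto elim!: dvdE)
  finally show ?thesis .
qed

lemma dyadic_class_unique:
  assumes "k \<in> dyadic_class n" "k \<in> dyadic_class m"
  shows "n = m"
proof -
  have "\<not> n < m" if "k \<in> dyadic_class n" "k \<in> dyadic_class m" for n m
    using that le_imp_power_dvd[of "Suc n" m "2::nat"] dvd_trans
    unfolding dyadic_class_dvd_iff Suc_le_eq by blast
  then show ?thesis using assms by (metis nat_neq_iff)
qed

lemma infinite_dyadic_class: "infinite (dyadic_class n)"
proof -
  have "dyadic_class n = range (\<lambda>t. 2 ^ n * (2 * t + 1))"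
    by (auto simp: dyadic_class_def)
  moreover have "inj (\<lambda>t::nat. 2 ^ n * (2 * t + 1) :: nat)"
    by (auto simp: inj_def)
  ultimately show ?thesis using range_inj_infinite by metis
qed

lemma decidable_dyadic_class:
  "decidable_in X (\<lambda>p. psnd p \<in> dyadic_class (pfst p))"
proof -
  have "k \<in> dyadic_class n \<longleftrightarrow> (\<exists>t<Suc k. k = 2 ^ n * (2 * t + 1))" for k n
  proof
    assume "k \<in> dyadic_class n"
    then obtain t where t: "k = 2 ^ n * (2 * t + 1)" by (auto simp: dyadic_class_def)
    have "1 * t \<le> k" unfolding t by (rule mult_le_mono) auto
    with t show "\<exists>t<Suc k. k = 2 ^ n * (2 * t + 1)" by auto
  qed (auto simp: dyadic_class_def)
  then show ?thesis
    by (simp only:) (intro computable_intros)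
qed

section \<open>Unions of blocks\<close>

lemma strict_mono_block_start: "strict_mono block_start"
  by (simp add: strict_mono_Suc_iff)

lemma le_block_start: "k \<le> block_start k"
  by (rule strict_mono_imp_increasing[OF strict_mono_block_start])

lemma card_block: "card (block k) = fact k"
  by (simp add: block_def)

lemma block_le: "x \<in> block k \<Longrightarrow> k \<le> x"
  using le_block_start[of k] by (simp add: block_def)

lemma block_disjoint:
  assumes "x \<in> block j" "x \<in> block k"
  shows "j = k"
proof -
  have "\<not> j < k" if "x \<in> block j" "x \<in> block k" for j k
    using that strict_mono_less_eq[OF strict_mono_block_start, of "Suc j" k]
    by (auto simp: block_def)
  then show ?thesis using assms by (metis nat_neq_iff)
qed

text \<open>Even counted twice, all points before block \<open>k\<close> are fewer than the points
  in it. This strict gap decides the final count. The induction starts at 5, and its step is 2 a_k +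
  2 k! < 3 k! \<le> (k + 1) k!.\<close>

lemma two_block_start_less_fact: "4 < k \<Longrightarrow> 2 * block_start k < fact k"
proof (induction k)
  case (Suc k)
  show ?case
  proof (cases "k = 4")
    case True
    then show ?thesis by (simp add: eval_nat_numeral)
  next
    case False
    with Suc have "2 * block_start k < fact k" by simp
    then have "2 * block_start (Suc k) < 3 * fact k" by simp
    also have "\<dots> \<le> Suc k * fact k" using Suc.prems by (intro mult_le_mono) auto
    finally show ?thesis by simp
  qed
qed simp

text \<open>This has two uses: \<open>A\<close> is the union over the sparse sequence, and the
  points that the \<open>n\<close>-th coding map covers twice form the union over the
  \<open>n\<close>-th dyadic class.\<close>

definition block_union :: "nat set \<Rightarrow> nat set" where
  "block_union R = (\<Union>k\<in>R. block k)"

lemma block_union_iff: "x \<in> block k \<Longrightarrow> x \<in> block_union R \<longleftrightarrow> k \<in> R"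
  unfolding block_union_def using block_disjoint by blast

lemma infinite_block_union:
  assumes "infinite R"
  shows "infinite (block_union R)"
proof -
  have "R \<subseteq> block_start -` block_union R"
    unfolding block_union_def by (auto intro!: bexI simp: block_def)
  then show ?thesis
    using assms finite_vimageI[OF _ strict_mono_imp_inj_on[OF strict_mono_block_start]]
      finite_subset by blast
qed

lemma decidable_block_union:
  assumes "decidable_in X (\<lambda>p. psnd p \<in> R (pfst p))"
  shows "decidable_in X (\<lambda>p. psnd p \<in> block_union (R (pfst p)))"
proof -
  \<comment> \<open>A block containing \<open>x\<close> has index at most \<open>x\<close>, so a
    bounded search suffices.\<close>
  have "x \<in> block_union S \<longleftrightarrow>
      (\<exists>k<Suc x. k \<in> S \<and> block_start k \<le> x \<and> x < block_start (Suc k))" for x S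
    using block_le[of x] by (fastforce simp: block_union_def block_def less_Suc_eq_le)
  then show ?thesis
    by (simp only:) (intro computable_intros computable_compose2[OF assms])
qed

section \<open>Maps covering a given set twice\<close>

text \<open>The even inputs already cover every number once, which gives surjectivity and the
  injective right inverse \<open>2 * y\<close>; the odd inputs add one further preimage for exactly
  the points of an infinite \<open>S\<close>.\<close>

definition doubling :: "nat set \<Rightarrow> nat \<Rightarrow> nat" where
  "doubling S x = (if even x then x div 2 else enumerate S (x div 2))"

lemma doubling_even [simp]: "doubling S (2 * x) = x"
  by (simp add: doubling_def)

lemma surj_doubling: "surj (doubling S)"
  by (metis doubling_even surjI)

text \<open>The \<open>q\<close>-th element of \<open>S\<close> is at least \<open>q\<close>. Hence
  all preimages of numbers below \<open>b\<close> lie below \<open>2 * b\<close>, which keeps the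
  search region in the main count computable.\<close>

lemma le_doubling:
  assumes "infinite S"
  shows "x < 2 * Suc (doubling S x)"
  using le_enumerate[OF assms, of "x div 2"] by (auto simp: doubling_def)

text \<open>Even preimages correspond to the points of \<open>F\<close>, odd ones to the points of
  \<open>F \<inter> S\<close>.\<close>

lemma doubling_vimage:
  assumes S: "infinite S" and F: "finite F"
  shows "finite (doubling S -` F)" "card (doubling S -` F) = card F + card (F \<inter> S)"
proof -
  let ?E = "enumerate S -` F"
  have inj: "inj (enumerate S)"
    using strict_mono_imp_inj_on[OF strict_mono_enumerate[OF S]] .
  have finE: "finite ?E" by (rule finite_vimageI[OF F inj])
  have "enumerate S ` ?E = F \<inter> S"
    using range_enumerate[OF S] by auto
  then have cardE: "card ?E = card (F \<inter> S)"
    using card_image[OF inj_on_subset[OF inj], of ?E] by auto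
  have split: "doubling S -` F = (\<lambda>x. 2 * x) ` F \<union> (\<lambda>x. 2 * x + 1) ` ?E" (is "?L = ?R")
  proof
    show "?L \<subseteq> ?R"
    proof
      fix x assume x: "x \<in> ?L"
      show "x \<in> ?R"
      proof (cases "even x")
        case True
        then obtain y where "x = 2 * y" ..
        with x show ?thesis by auto
      next
        case False
        then obtain y where "x = 2 * y + 1" ..
        with x show ?thesis by (auto simp: doubling_def)
      qed
    qed
  qed (auto simp: doubling_def)
  show "finite (doubling S -` F)" unfolding split using F finE by simp
  have "card (doubling S -` F) = card ((\<lambda>x. 2 * x) ` F) + card ((\<lambda>x. 2 * x + 1) ` ?E)"
    unfolding split by (rule card_Un_disjoint) (use F finE in \<open>auto, presburger\<close>)
  then show "card (doubling S -` F) = card F + card (F \<inter> S)"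
    using cardE by (simp add: card_image inj_on_def)
qed

lemma doubling_fibre:
  assumes "infinite S"
  shows "finite (doubling S -` {y}) \<and> card (doubling S -` {y}) \<le> 2"
  using doubling_vimage[OF assms, of "{y}"] card_mono[of "{y}" "{y} \<inter> S"] by auto

lemma computable_doubling:
  assumes dec: "decidable_in X (\<lambda>p. psnd p \<in> S (pfst p))" and inf: "\<And>i. infinite (S i)"
  shows "computable_in X (\<lambda>p. doubling (S (pfst p)) (psnd p))"
proof -
  \<comment> \<open>Halving is written as a search, and parity is then read off from it.\<close>
  have half: "x div 2 = (LEAST q. x < 2 * q + 2)" for x :: nat
    by (rule Least_equality[symmetric]) auto
  have ex: "\<exists>q. x < 2 * q + 2" for x :: nat
    by (rule exI[of _ x]) simp
  have "even x \<longleftrightarrow> x = 2 * (x div 2)" for x :: nat by presburger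
  then show ?thesis
    unfolding doubling_def half
    by (simp only:) (intro computable_intros computable_enumerate dec inf computable_Least ex)
qed

section \<open>Reducibilities\<close>

lemma bfo_reducible_if_one_reducible:
  assumes "A \<le>\<^sub>1 B"
  shows "A \<le>\<^sub>b\<^sub>f\<^sub>o B"
proof -
  obtain f where f: "computable f" "inj f" "\<forall>x. x \<in> A \<longleftrightarrow> f x \<in> B"
    using assms by (auto simp: one_reducible_def)
  have "finite (f -` {y}) \<and> card (f -` {y}) \<le> 1" for y
    using finite_vimageI[OF _ f(2), of "{y}"] card_vimage_inj_on_le[OF f(2), of "{y}"] by simp
  with f show ?thesis unfolding bfo_reducible_def by blast
qed

text \<open>A fibre of the composite is a union of at most \<open>d\<close> fibres of size at most
  \<open>c\<close>.\<close>

lemma bfo_reducible_trans: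
  assumes "A \<le>\<^sub>b\<^sub>f\<^sub>o B" "B \<le>\<^sub>b\<^sub>f\<^sub>o C"
  shows "A \<le>\<^sub>b\<^sub>f\<^sub>o C"
proof -
  obtain f c where f: "computable f" "c \<ge> 1" "\<forall>x. x \<in> A \<longleftrightarrow> f x \<in> B"
    "\<And>y. finite (f -` {y}) \<and> card (f -` {y}) \<le> c"
    using assms(1) by (auto simp: bfo_reducible_def)
  obtain g d where g: "computable g" "d \<ge> 1" "\<forall>x. x \<in> B \<longleftrightarrow> g x \<in> C"
    "\<And>y. finite (g -` {y}) \<and> card (g -` {y}) \<le> d"
    using assms(2) by (auto simp: bfo_reducible_def)
  have vim: "(g \<circ> f) -` {z} = (\<Union>y\<in>g -` {z}. f -` {y})" for z by auto
  have "finite ((g \<circ> f) -` {z}) \<and> card ((g \<circ> f) -` {z}) \<le> d * c" for z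
  proof
    show "finite ((g \<circ> f) -` {z})" unfolding vim using f(4) g(4) by blast
    have "card ((g \<circ> f) -` {z}) \<le> (\<Sum>y\<in>g -` {z}. card (f -` {y}))"
      unfolding vim using g(4) by (intro card_UN_le) blast
    also have "\<dots> \<le> card (g -` {z}) * c"
      using sum_bounded_above[of "g -` {z}" "\<lambda>y. card (f -` {y})" c] f(4) by simp
    also have "\<dots> \<le> d * c" using g(4) by simp
    finally show "card ((g \<circ> f) -` {z}) \<le> d * c" .
  qed
  moreover have "d * c \<ge> 1" using f(2) g(2) by (metis mult_le_mono mult_1)
  moreover have "\<forall>x. x \<in> A \<longleftrightarrow> (g \<circ> f) x \<in> C" using f(3) g(3) by simp
  ultimately show ?thesis
    unfolding bfo_reducible_def using computable_in_comp[OF g(1) f(1)] by blast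
qed

lemma one_degree_subset_bfo_degree: "X \<equiv>\<^sub>b\<^sub>f\<^sub>o A \<Longrightarrow> one_degree X \<subseteq> bfo_degree A"
  unfolding one_degree_def bfo_degree_def one_equiv_def bfo_equiv_def
  using bfo_reducible_if_one_reducible bfo_reducible_trans by blast

text \<open>The coding map is itself a reduction with constant 2; its right inverse
  \<open>2 * x\<close> reduces back and is even injective.\<close>

lemma bfo_equiv_doubling:
  assumes "infinite S" "computable (doubling S)"
  shows "{x. doubling S x \<in> A} \<equiv>\<^sub>b\<^sub>f\<^sub>o A"
  unfolding bfo_equiv_def
proof
  show "{x. doubling S x \<in> A} \<le>\<^sub>b\<^sub>f\<^sub>o A"
    unfolding bfo_reducible_def using assms doubling_fibre[OF assms(1)]
    by (intro exI[of _ "doubling S"] exI[of _ 2]) auto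
  have "A \<le>\<^sub>1 {x. doubling S x \<in> A}"
    unfolding one_reducible_def
  proof (intro exI conjI)
    show "computable (\<lambda>x. 2 * x)" by (intro computable_intros)
  qed (auto intro: injI)
  then show "A \<le>\<^sub>b\<^sub>f\<^sub>o {x. doubling S x \<in> A}" by (rule bfo_reducible_if_one_reducible)
qed

section \<open>The antichain\<close>

abbreviation dyadic_doubling :: "nat \<Rightarrow> nat \<Rightarrow> nat" where
  "dyadic_doubling n \<equiv> doubling (block_union (dyadic_class n))"

text \<open>Index \<open>Suc s\<close> is assigned to the class \<open>pfst s\<close>, so each class
  is visited infinitely often. The shift is there because the starting value 0 belongs to no
  class.\<close>

lemma sparse_dyadic_sequence:
  assumes "computable_in X g"
  obtains r where "computable_in X r" "strict_mono r"
    and "\<forall>s. r (Suc s) \<in> dyadic_class (pfst s)" "\<forall>s. g (r s) < r (Suc s)"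
proof
  \<comment> \<open>The odd factor exceeds both the previous value \<open>y\<close> and
    \<open>g y\<close>, and the power of 2 puts the product into the required class.\<close>
  let ?r = "rec_nat 0 (\<lambda>s y. 2 ^ pfst s * (2 * (g y + y) + 1))"
  show "computable_in X ?r"
    by (intro computable_rec computable_intros computable_compose[OF assms])
  have less: "g (?r s) + ?r s < ?r (Suc s)" for s
  proof -
    have "1 * (g (?r s) + ?r s + 1) \<le> ?r (Suc s)"
      unfolding nat.rec(2) by (rule mult_le_mono) auto
    then show ?thesis by simp
  qed
  show "strict_mono ?r"
    unfolding strict_mono_Suc_iff
  proof
    show "?r s < ?r (Suc s)" for s using less[of s] by linarith
  qed
  show "\<forall>s. g (?r s) < ?r (Suc s)" by (intro allI add_lessD1[OF less])
  show "\<forall>s. ?r (Suc s) \<in> dyadic_class (pfst s)" unfolding dyadic_class_def nat.rec(2) by blast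
qed

text \<open>
  For \<open>k = r (Suc s)\<close> in the class of \<open>n\<close>, the \<open>2 * fact k\<close> elements over \<open>block k\<close> can only go to
  elements over \<open>block k\<close> or below, since the next block of the set starts beyond everything that
  the reduction reaches from there.
\<close>

lemma not_one_reducible:
  assumes mono: "strict_mono r"
    and dyadic: "\<forall>s. r (Suc s) \<in> dyadic_class (pfst s)"
    and sparse: "\<forall>s. g (r s) < r (Suc s)"
    and dom: "\<And>f. computable f \<Longrightarrow> \<exists>k. \<forall>x\<ge>k. f x \<le> g x"
    and comp: "computable (dyadic_doubling m)"
    and "n \<noteq> m"
  shows "\<not> {x. dyadic_doubling n x \<in> block_union (range r)} \<le>\<^sub>1
           {x. dyadic_doubling m x \<in> block_union (range r)}"
proof
  have inf: "infinite (block_union (dyadic_class i))" for i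
    by (intro infinite_block_union infinite_dyadic_class)
  assume "{x. dyadic_doubling n x \<in> block_union (range r)} \<le>\<^sub>1
          {x. dyadic_doubling m x \<in> block_union (range r)}"
  then obtain f where f: "computable f" "inj f"
    and red: "\<And>x. dyadic_doubling n x \<in> block_union (range r) \<longleftrightarrow>
                dyadic_doubling m (f x) \<in> block_union (range r)"
    unfolding one_reducible_def by auto
  \<comment> \<open>By \<open>le_doubling\<close> the sum includes every \<open>x\<close> over a
    block of index at most \<open>b\<close>, so \<open>F b\<close> majorises all values reached from
    there. It is computable, hence eventually below \<open>g\<close>.\<close>
  define F where "F b = (\<Sum>x<2 * block_start (Suc b). dyadic_doubling m (f x))" for b
  have "computable F"
    unfolding F_def
    by (intro computable_intros computable_compose[OF comp] computable_compose[OF f(1)])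
  then obtain k0 where k0: "\<And>x. x \<ge> k0 \<Longrightarrow> F x \<le> g x" using dom by blast
  \<comment> \<open>The first component selects the class of \<open>n\<close>; the second forces
    \<open>k\<close> past both \<open>k0\<close> and 4.\<close>
  define s where "s = prod_encode (n, k0 + 4)"
  define k where "k = r (Suc s)"
  have "k0 + 4 \<le> s" unfolding s_def by (rule le_prod_encode_2)
  moreover have "Suc s \<le> k" unfolding k_def by (rule strict_mono_imp_increasing[OF mono])
  ultimately have k: "k0 \<le> k" "4 < k" by auto
  have kn: "k \<in> dyadic_class n" using dyadic[rule_format, of s] by (simp add: k_def s_def)
  then have km: "k \<notin> dyadic_class m" using dyadic_class_unique \<open>n \<noteq> m\<close> by blast
  let ?X = "dyadic_doubling n -` block k"
  let ?Y = "dyadic_doubling m -` {..<block_start (Suc k)}"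
  have fin: "finite (block k)" by (simp add: block_def)
  have "f ` ?X \<subseteq> ?Y"
  proof (rule image_subsetI)
    fix x assume x: "x \<in> ?X"
    then have "x < 2 * block_start (Suc k)"
      using le_doubling[OF inf, of x n] by (simp add: block_def)
    then have "dyadic_doubling m (f x) \<le> F k"
      unfolding F_def by (intro member_le_sum) auto
    also have "\<dots> \<le> g k" using k0 k by simp
    also have "\<dots> < r (Suc (Suc s))" unfolding k_def by (rule sparse[rule_format])
    finally have bound: "dyadic_doubling m (f x) < r (Suc (Suc s))" .
    \<comment> \<open>Since \<open>k\<close> is in the sequence, \<open>x\<close> lies in the first
      set, so its image lies over some block \<open>r j\<close> of the union; the bound excludes
      every \<open>j\<close> beyond \<open>Suc s\<close>.\<close>
    have "dyadic_doubling n x \<in> block_union (range r)"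
      using x block_union_iff[of _ k "range r"] by (auto simp: k_def)
    then obtain j where j: "dyadic_doubling m (f x) \<in> block (r j)"
      unfolding red by (auto simp: block_union_def)
    have "r j < r (Suc (Suc s))" using block_le[OF j] bound by simp
    then have "r j \<le> k"
      using strict_mono_less[OF mono] strict_mono_less_eq[OF mono] by (simp add: k_def)
    then have "block_start (Suc (r j)) \<le> block_start (Suc k)"
      by (subst strict_mono_less_eq[OF strict_mono_block_start]) simp
    then show "f x \<in> ?Y" using j by (simp add: block_def)
  qed
  then have "card ?X \<le> card ?Y"
    by (rule card_inj_on_le[OF inj_on_subset[OF f(2) subset_UNIV]])
      (simp add: doubling_vimage(1)[OF inf])
  moreover have "card ?X = 2 * fact k"
  proof -
    have "block k \<inter> block_union (dyadic_class n) = block k"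
      using kn by (auto simp: block_union_def)
    then show ?thesis by (simp add: doubling_vimage(2)[OF inf fin] card_block)
  qed
  \<comment> \<open>Block \<open>k\<close> is covered once by the \<open>m\<close>-th map because
    \<open>k\<close> is outside the class of \<open>m\<close>; earlier points are covered at most
    twice.\<close>
  moreover have "card ?Y \<le> 2 * block_start k + fact k"
  proof -
    have "{..<block_start (Suc k)} \<inter> block_union (dyadic_class m) \<subseteq> {..<block_start k}"
    proof
      fix x assume x: "x \<in> {..<block_start (Suc k)} \<inter> block_union (dyadic_class m)"
      then have "x \<notin> block k" using km block_union_iff by blast
      then show "x \<in> {..<block_start k}" using x by (auto simp: block_def)
    qed
    then have "card ({..<block_start (Suc k)} \<inter> block_union (dyadic_class m)) \<le> block_start k"
      using card_mono[OF finite_lessThan] by fastforce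
    then show ?thesis by (simp add: doubling_vimage(2)[OF inf])
  qed
  ultimately show False using two_block_start_less_fact[OF k(2)] by simp
qed

text \<open>At an index in class \<open>i\<close> the left profile equals \<beta>, which forces that
  index into class \<open>j\<close> as well. The monotonicity clause of the coding thus reduces to
  reflexivity.\<close>

lemma dyadic_profile_le_iff:
  assumes "\<alpha> < \<beta>"
  shows "(\<forall>k. dyadic_profile \<alpha> \<beta> i k \<le> dyadic_profile \<alpha> \<beta> j k) \<longleftrightarrow> i = j"
proof
  assume le: "\<forall>k. dyadic_profile \<alpha> \<beta> i k \<le> dyadic_profile \<alpha> \<beta> j k"
  obtain k where k: "k \<in> dyadic_class i"
    using infinite_imp_nonempty[OF infinite_dyadic_class] by blast
  have "k \<in> dyadic_class j"
  proof (rule ccontr)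
    assume "k \<notin> dyadic_class j"
    then show False using le[rule_format, of k] k assms by (simp add: dyadic_profile_def)
  qed
  with k show "i = j" by (rule dyadic_class_unique)
qed simp

theorem corollary3p5:
  fixes \<alpha> \<beta> :: rat
  assumes "1 < \<alpha>" and "\<alpha> < \<beta>" and "\<beta> < 2"
  shows "disjoint_family dyadic_class \<and>
    (\<forall>n. infinite (dyadic_class n)) \<and>
    uniformly_computable_sets dyadic_class \<and>
    (\<forall>n. block_density_profile (dyadic_profile \<alpha> \<beta> n)) \<and>
    (\<exists>A h. A \<le>\<^sub>T turing_jump {} \<and>
       uniformly_computable h \<and>
       (\<forall>n. surj (h n)) \<and>
       profile_coding (dyadic_profile \<alpha> \<beta>) {(n, m). n \<noteq> m} A h \<and>
       (let W = coded_set A h in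
          (\<forall>n. W n \<equiv>\<^sub>b\<^sub>f\<^sub>o A) \<and>
          (\<forall>n m. n \<noteq> m \<longrightarrow> \<not> W n \<le>\<^sub>1 W m) \<and>
          infinite (range (\<lambda>n. one_degree (W n))) \<and>
          pairwise (\<lambda>d e. \<not> one_degree_le d e) (range (\<lambda>n. one_degree (W n))) \<and>
          (\<forall>n. one_degree (W n) \<subseteq> bfo_degree A)))"
proof (intro conjI allI)
  show "disjoint_family dyadic_class"
    unfolding disjoint_family_on_def using dyadic_class_unique by blast
  show "infinite (dyadic_class n)" for n by (rule infinite_dyadic_class)
  show "uniformly_computable_sets dyadic_class"
    unfolding uniformly_computable_sets_def uniformly_computable_iff
    by (rule decidable_dyadic_class)
  show "block_density_profile (dyadic_profile \<alpha> \<beta> n)" for n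
    using assms by (auto simp: block_density_profile_def dyadic_profile_def)
  obtain g where g: "computable_in (turing_jump {}) g"
    and dom: "\<And>f. computable f \<Longrightarrow> \<exists>k. \<forall>x\<ge>k. f x \<le> g x"
    using turing_jump_dominating[of "{}"] by auto
  obtain r where r: "computable_in (turing_jump {}) r" "strict_mono r"
      "\<forall>s. r (Suc s) \<in> dyadic_class (pfst s)" "\<forall>s. g (r s) < r (Suc s)"
    by (rule sparse_dyadic_sequence[OF g])
  define A where "A = block_union (range r)"
  let ?h = dyadic_doubling
  let ?W = "coded_set A ?h"
  have inf: "infinite (block_union (dyadic_class n))" for n
    by (intro infinite_block_union infinite_dyadic_class)
  have h: "computable (\<lambda>p. ?h (pfst p) (psnd p))"
    by (intro computable_doubling decidable_block_union decidable_dyadic_class inf)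
  have h': "computable (?h n)" for n
    using computable_compose2[OF h computable_const computable_ident] .
  have A: "A \<le>\<^sub>T turing_jump {}"
  proof -
    \<comment> \<open>A strictly increasing sequence satisfies \<open>s \<le> r s\<close>, so
      membership in its range is a bounded search using \<open>r\<close>.\<close>
    have "k \<in> range r \<longleftrightarrow> (\<exists>s<Suc k. r s = k)" for k
      using strict_mono_imp_increasing[OF r(2)] by (auto simp: less_Suc_eq_le)
    then have "decidable_in (turing_jump {}) (\<lambda>p. psnd p \<in> range r)"
      by (simp only:) (intro computable_intros computable_compose[OF r(1)])
    from decidable_block_union[OF this]
    have "decidable_in (turing_jump {}) (\<lambda>p. psnd p \<in> A)" by (simp only: A_def)
    from computable_compose2[OF this computable_const computable_ident]
    show ?thesis unfolding turing_reducible_def .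
  qed
  have equiv: "?W n \<equiv>\<^sub>b\<^sub>f\<^sub>o A" for n
    unfolding coded_set_def by (rule bfo_equiv_doubling[OF inf h'])
  have antichain: "\<not> ?W n \<le>\<^sub>1 ?W m" if "n \<noteq> m" for n m
    unfolding coded_set_def A_def by (rule not_one_reducible[OF r(2-4) dom h' that])
  have coding: "profile_coding (dyadic_profile \<alpha> \<beta>) {(n, m). n \<noteq> m} A ?h"
    unfolding profile_coding_def dyadic_profile_le_iff[OF assms(2)]
  proof (intro conjI)
    show "\<forall>k. \<forall>x\<in>block k. \<forall>y\<in>block k. x \<in> A \<longleftrightarrow> y \<in> A"
      unfolding A_def using block_union_iff by blast
    show "\<forall>i y. finite (?h i -` {y}) \<and> card (?h i -` {y}) \<le> 2"
      using doubling_fibre[OF inf] by blast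
    show "\<forall>i. ?W i \<equiv>\<^sub>b\<^sub>f\<^sub>o A" using equiv by blast
    show "\<forall>i j. i = j \<longrightarrow> ?W i \<le>\<^sub>1 ?W j" using one_reducible_refl by simp
    show "\<forall>(i, j)\<in>{(n, m). n \<noteq> m}. \<not> ?W i \<le>\<^sub>1 ?W j" using antichain by blast
  qed
  \<comment> \<open>Equal degrees would give a 1-reduction between two members of the antichain, so
    distinct indices have distinct degrees.\<close>
  have "inj (\<lambda>n. one_degree (?W n))"
  proof (rule injI, rule ccontr)
    fix n m assume "one_degree (?W n) = one_degree (?W m)" "n \<noteq> m"
    then show False
      using antichain[of n m] one_degree_le_iff[of "?W n" "?W m"]
        one_degree_le_iff[of "?W m" "?W m"] one_reducible_refl by simp
  qed
  then have inf_range: "infinite (range (\<lambda>n. one_degree (?W n)))"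
    by (rule range_inj_infinite)
  have pw: "pairwise (\<lambda>d e. \<not> one_degree_le d e) (range (\<lambda>n. one_degree (?W n)))"
  proof (rule pairwiseI, elim imageE)
    fix d e n m assume "d \<noteq> e" and d: "d = one_degree (?W n)" and e: "e = one_degree (?W m)"
    then have "n \<noteq> m" by blast
    then show "\<not> one_degree_le d e" unfolding d e one_degree_le_iff by (rule antichain)
  qed
  show "\<exists>A h. A \<le>\<^sub>T turing_jump {} \<and>
       uniformly_computable h \<and>
       (\<forall>n. surj (h n)) \<and>
       profile_coding (dyadic_profile \<alpha> \<beta>) {(n, m). n \<noteq> m} A h \<and>
       (let W = coded_set A h in
          (\<forall>n. W n \<equiv>\<^sub>b\<^sub>f\<^sub>o A) \<and>
          (\<forall>n m. n \<noteq> m \<longrightarrow> \<not> W n \<le>\<^sub>1 W m) \<and>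
          infinite (range (\<lambda>n. one_degree (W n))) \<and>
          pairwise (\<lambda>d e. \<not> one_degree_le d e) (range (\<lambda>n. one_degree (W n))) \<and>
          (\<forall>n. one_degree (W n) \<subseteq> bfo_degree A))"
    unfolding Let_def
  proof (rule exI[of _ A], rule exI[of _ ?h], intro conjI allI impI)
    show "uniformly_computable ?h" unfolding uniformly_computable_iff by (rule h)
    show "one_degree (?W n) \<subseteq> bfo_degree A" for n
      by (rule one_degree_subset_bfo_degree[OF equiv])
  qed (rule A surj_doubling coding equiv antichain inf_range pw, assumption?)+
qed

end
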